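(* Let $G,H$ be two colored prime graphs of twin-width at most $1$ such that $G\not\cong H$ (as colored graphs). Then the $3$-dimensional Weisfeiler-Leman algorithm distinguishes $G$ and $H$.
   Context: All graphs are finite and simple. A colored graph is a graph with a vertex coloring $c:V(G)\to\mathbb{N}$; isomorphisms preserve colors; twin-width of a colored graph is that of its underlying graph (defined via partition sequences: merge two parts at a time starting from singletons; in the quotient trigraph two parts are joined by a red edge if they are neither fully adjacent nor fully non-adjacent; width = max red degree; twin-width = min width). A module is a vertex set $M$ such that every vertex outside $M$ is adjacent to all or none of $M$; $G$ is prime if its only modules are singletons and $V(G)$. For colored graphs, the $k$-dimensional Weisfeiler-Leman algorithm starts from the atomic type of each $k$-tuple (including the colors of its entries, equalities and adjacencies) and refines by $\chi^{i+1}(\vec v)=(\chi^i(\vec v),\{\!\{(\mathrm{atp}(\vec v w),\chi^i(\vec v[w/1]),\dots,\chi^i(\vec v[w/k])):w\in V(G)\}\!\})$ until stable; it distinguishes $G,H$ if some stable color has different multiplicities in $V(G)^k$ and $V(H)^k$. *)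

theory Defs
  imports "Graph_Theory.Pair_Digraph" "HOL-Library.Multiset"
begin

text \<open>
  A finite simple graph is a \<^locale>\<open>pair_graph\<close>: a finite, loop-free digraph without parallel arcs
  whose arc relation is symmetric, so \<open>u\<close> and \<open>v\<close> are adjacent iff \<open>(u, v) \<in> parcs G\<close>.
  A colored graph is such a \<open>G\<close> together with \<open>c :: 'a \<Rightarrow> nat\<close>, of which only the values on
  \<open>pverts G\<close> matter.
\<close>

definition colored_iso ::
  "'a pair_pre_digraph \<Rightarrow> ('a \<Rightarrow> nat) \<Rightarrow> 'b pair_pre_digraph \<Rightarrow> ('b \<Rightarrow> nat) \<Rightarrow> bool" where
  "colored_iso G c H d \<longleftrightarrow>
    (\<exists>f. bij_betw f (pverts G) (pverts H) \<and>
         (\<forall>u\<in>pverts G. \<forall>v\<in>pverts G. (u, v) \<in> parcs G \<longleftrightarrow> (f u, f v) \<in> parcs H) \<and>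
         (\<forall>u\<in>pverts G. d (f u) = c u))"


section \<open>Modules and prime graphs\<close>

text \<open>The empty set is not counted as a module; otherwise no nonempty graph would be prime.\<close>

definition graph_module :: "'a pair_pre_digraph \<Rightarrow> 'a set \<Rightarrow> bool" where
  "graph_module G M \<longleftrightarrow> M \<noteq> {} \<and> M \<subseteq> pverts G \<and>
    (\<forall>v\<in>pverts G - M. (\<forall>m\<in>M. (v, m) \<in> parcs G) \<or> (\<forall>m\<in>M. (v, m) \<notin> parcs G))"

definition prime_graph :: "'a pair_pre_digraph \<Rightarrow> bool" where
  "prime_graph G \<longleftrightarrow> (\<forall>M. graph_module G M \<longrightarrow> is_singleton M \<or> M = pverts G)"


section \<open>Twin-width\<close>

definition red_edge :: "'a pair_pre_digraph \<Rightarrow> 'a set \<Rightarrow> 'a set \<Rightarrow> bool" where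
  "red_edge G A B \<longleftrightarrow> A \<noteq> B \<and>
    \<not> (\<forall>a\<in>A. \<forall>b\<in>B. (a, b) \<in> parcs G) \<and> \<not> (\<forall>a\<in>A. \<forall>b\<in>B. (a, b) \<notin> parcs G)"

definition red_degree :: "'a pair_pre_digraph \<Rightarrow> 'a set set \<Rightarrow> 'a set \<Rightarrow> nat" where
  "red_degree G P A = card {B \<in> P. red_edge G A B}"

definition merge_step :: "'a set set \<Rightarrow> 'a set set \<Rightarrow> bool" where
  "merge_step P Q \<longleftrightarrow> (\<exists>A\<in>P. \<exists>B\<in>P. A \<noteq> B \<and> Q = insert (A \<union> B) (P - {A, B}))"

text \<open>
  Ending with at most one part means ending with the partition \<open>{pverts G}\<close>, except that the
  empty graph has the empty partition and the one-element sequence consisting of it.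
\<close>

definition partition_sequence :: "'a pair_pre_digraph \<Rightarrow> 'a set set list \<Rightarrow> bool" where
  "partition_sequence G Ps \<longleftrightarrow> Ps \<noteq> [] \<and>
    hd Ps = (\<lambda>v. {v}) ` pverts G \<and>
    (\<forall>i. Suc i < length Ps \<longrightarrow> merge_step (Ps ! i) (Ps ! Suc i)) \<and>
    card (last Ps) \<le> 1"

definition sequence_width :: "'a pair_pre_digraph \<Rightarrow> 'a set set list \<Rightarrow> nat" where
  "sequence_width G Ps = Max (insert 0 (\<Union>P\<in>set Ps. red_degree G P ` P))"

definition twin_width :: "'a pair_pre_digraph \<Rightarrow> nat" where
  "twin_width G = (LEAST w. \<exists>Ps. partition_sequence G Ps \<and> sequence_width G Ps = w)"


section \<open>The Weisfeiler-Leman algorithm\<close>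

text \<open>
  Colors, equalities and adjacencies of the entries of a tuple. Tuples are lists, and positions
  are counted from \<open>0\<close>.
\<close>

type_synonym atomic_type = "nat list \<times> (nat \<times> nat) set \<times> (nat \<times> nat) set"

definition atp :: "'a pair_pre_digraph \<Rightarrow> ('a \<Rightarrow> nat) \<Rightarrow> 'a list \<Rightarrow> atomic_type" where
  "atp G c vs =
    (map c vs,
     {(i, j). i < length vs \<and> j < length vs \<and> vs ! i = vs ! j},
     {(i, j). i < length vs \<and> j < length vs \<and> (vs ! i, vs ! j) \<in> parcs G})"

text \<open>
  Colors are syntactic and do not mention vertices, so that colors of tuples in different graphs
  can be compared by equality.
\<close>

datatype wl_color =
    Initial atomic_type
  | Refined wl_color "(atomic_type \<times> wl_color list) multiset"

fun wl :: "nat \<Rightarrow> 'a pair_pre_digraph \<Rightarrow> ('a \<Rightarrow> nat) \<Rightarrow> nat \<Rightarrow> 'a list \<Rightarrow> wl_color" where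
  "wl k G c 0 vs = Initial (atp G c vs)"
| "wl k G c (Suc i) vs =
     Refined (wl k G c i vs)
       {# (atp G c (vs @ [w]), map (\<lambda>j. wl k G c i (vs[j := w])) [0..<k]).
          w \<in># mset_set (pverts G) #}"

definition vertex_tuples :: "nat \<Rightarrow> 'a pair_pre_digraph \<Rightarrow> 'a list set" where
  "vertex_tuples k G = {vs. length vs = k \<and> set vs \<subseteq> pverts G}"

text \<open>
  The algorithm is run on the tuples of both graphs simultaneously, so stability refers to the
  partition of the disjoint union of the two sets of tuples. Stability of the two colorings
  separately would be too weak: two regular graphs of different degrees are already stable under
  color refinement in round \<open>0\<close>, with the same color everywhere.
\<close>

definition wl_joint ::
  "nat \<Rightarrow> 'a pair_pre_digraph \<Rightarrow> ('a \<Rightarrow> nat) \<Rightarrow> 'b pair_pre_digraph \<Rightarrow> ('b \<Rightarrow> nat) \<Rightarrow>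
   nat \<Rightarrow> 'a list + 'b list \<Rightarrow> wl_color" where
  "wl_joint k G c H d i = case_sum (wl k G c i) (wl k H d i)"

definition wl_stable ::
  "nat \<Rightarrow> 'a pair_pre_digraph \<Rightarrow> ('a \<Rightarrow> nat) \<Rightarrow> 'b pair_pre_digraph \<Rightarrow> ('b \<Rightarrow> nat) \<Rightarrow>
   nat \<Rightarrow> bool" where
  "wl_stable k G c H d i \<longleftrightarrow>
    (\<forall>x \<in> vertex_tuples k G <+> vertex_tuples k H. \<forall>y \<in> vertex_tuples k G <+> vertex_tuples k H.
       wl_joint k G c H d i x = wl_joint k G c H d i y \<longrightarrow>
       wl_joint k G c H d (Suc i) x = wl_joint k G c H d (Suc i) y)"

definition wl_stable_round ::
  "nat \<Rightarrow> 'a pair_pre_digraph \<Rightarrow> ('a \<Rightarrow> nat) \<Rightarrow> 'b pair_pre_digraph \<Rightarrow> ('b \<Rightarrow> nat) \<Rightarrow> nat" where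
  "wl_stable_round k G c H d = (LEAST i. wl_stable k G c H d i)"

definition wl_distinguishes ::
  "nat \<Rightarrow> 'a pair_pre_digraph \<Rightarrow> ('a \<Rightarrow> nat) \<Rightarrow> 'b pair_pre_digraph \<Rightarrow> ('b \<Rightarrow> nat) \<Rightarrow> bool" where
  "wl_distinguishes k G c H d \<longleftrightarrow>
    (let s = wl_stable_round k G c H d in
     \<exists>q. card {vs \<in> vertex_tuples k G. wl k G c s vs = q} \<noteq>
         card {vs \<in> vertex_tuples k H. wl k H d s vs = q})"

end

theory Submission
  imports Defs "HOL-Library.Disjoint_Sets"
begin

text \<open>
  In a prime graph every part of a partition that is neither a singleton nor the whole vertex set
  has a red edge. A red edge survives every merge other than that of its two ends, and the union of
  the ends then has a red edge again. So, reading a sequence of width 1 backwards, each of its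
  partitions has at most one red edge. Let \<open>a\<close> and \<open>b\<close> be the vertices that are merged first.
  Color refinement with \<open>a\<close> and \<open>b\<close> individualized singles out every vertex that occurs in a merged
  part, by induction along the sequence: a vertex of the same color as the next one to be merged
  would be its twin. Three-dimensional Weisfeiler-Leman on the triples \<open>(a, b, w)\<close> simulates this
  refinement, and equality of the resulting discrete colorings is an isomorphism.
\<close>

section \<open>Red edges along a partition sequence\<close>

lemma merge_stepE:
  assumes "merge_step P Q"
  obtains X Y where "X \<in> P" "Y \<in> P" "X \<noteq> Y" "Q = insert (X \<union> Y) (P - {X, Y})"
  using assms unfolding merge_step_def by blast

lemma merge_step_partition_on:
  assumes "merge_step P Q" and P: "partition_on V P"
  shows "partition_on V Q"
proof -
  obtain X Y where XY: "X \<in> P" "Y \<in> P" "X \<noteq> Y" and Q: "Q = insert (X \<union> Y) (P - {X, Y})"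
    using assms(1) by (rule merge_stepE)
  show ?thesis
  proof (rule partition_onI)
    show "\<Union>Q = V" using XY Q partition_onD1[OF P] by auto
    show "{} \<notin> Q" using XY Q partition_onD3[OF P] by auto
    have disj: "disjnt p q" if "p \<in> P" "q \<in> P" "p \<noteq> q" for p q
      using that partition_onD2[OF P] by (auto simp: disjnt_def dest: disjointD)
    have disj_merged: "disjnt (X \<union> Y) p" if "p \<in> P - {X, Y}" for p
      using that disj[OF XY(1), of p] disj[OF XY(2), of p] by (auto simp: disjnt_Un1)
    show "disjnt p q" if pq: "p \<in> Q" "q \<in> Q" "p \<noteq> q" for p q
      using pq(1) unfolding Q
    proof
      assume p: "p = X \<union> Y"
      then have "q \<in> P - {X, Y}" using pq(2,3) Q by simp
      then show ?thesis using p disj_merged by simp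
    next
      assume p: "p \<in> P - {X, Y}"
      from pq(2) show ?thesis unfolding Q
      proof
        assume "q = X \<union> Y"
        then show ?thesis using disj_merged[OF p] by (simp add: disjnt_sym)
      next
        assume "q \<in> P - {X, Y}"
        then show ?thesis using disj p pq(3) by simp
      qed
    qed
  qed
qed

lemma union_of_parts_not_singleton:
  assumes P: "partition_on V P" and "X \<in> P" "Y \<in> P" "X \<noteq> Y"
  shows "\<not> is_singleton (X \<union> Y)"
proof -
  obtain x y where "x \<in> X" "y \<in> Y" using partition_onD3[OF P] assms(2,3) by (metis all_not_in_conv)
  moreover have "X \<inter> Y = {}"
    using partition_onD2[OF P] assms(2-4) by (auto dest: disjointD)
  then have "x \<noteq> y" using calculation by blast
  ultimately show ?thesis by (metis UnI1 UnI2 is_singletonE singletonD)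
qed

lemma merge_step_card:
  assumes "merge_step P Q" and P: "partition_on V P" and "finite V"
  shows "card Q < card P"
proof -
  obtain X Y where XY: "X \<in> P" "Y \<in> P" "X \<noteq> Y" and Q: "Q = insert (X \<union> Y) (P - {X, Y})"
    using assms(1) by (rule merge_stepE)
  have fin: "finite P" using finite_elements[OF \<open>finite V\<close> P] .
  have "card {X, Y} \<le> card P" using XY fin by (intro card_mono) auto
  moreover have "card (P - {X, Y}) = card P - 2"
    using XY fin by (subst card_Diff_subset) auto
  moreover have "card Q \<le> Suc (card (P - {X, Y}))"
    unfolding Q by (rule card_insert_le_m1) auto
  ultimately show ?thesis using XY by simp
qed

section \<open>Partition sequences and the twin-width they attain\<close>

lemma partition_on_singletons: "partition_on V ((\<lambda>v. {v}) ` V)"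
  by (rule partition_onI) (auto simp: disjnt_def)

text \<open>Guarantees that the \<open>LEAST\<close> in \<open>twin_width\<close> ranges over a
  nonempty set. Every merge lowers the number of parts, so merging can go on until at most one is
  left.\<close>

lemma merge_steps_exist:
  assumes "partition_on V P" and "finite V"
  shows "\<exists>Ps. Ps \<noteq> [] \<and> hd Ps = P \<and>
    (\<forall>i. Suc i < length Ps \<longrightarrow> merge_step (Ps ! i) (Ps ! Suc i)) \<and> card (last Ps) \<le> 1"
  using assms(1)
proof (induction "card P" arbitrary: P rule: less_induct)
  case less
  show ?case
  proof (cases "card P \<le> 1")
    case True
    then show ?thesis by (intro exI[of _ "[P]"]) auto
  next
    case False
    then obtain X Y where "X \<in> P" "Y \<in> P" "X \<noteq> Y"
      using card_le_Suc0_iff_eq[OF finite_elements[OF assms(2) less.prems]] by auto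
    then have step: "merge_step P (insert (X \<union> Y) (P - {X, Y}))" (is "merge_step P ?Q")
      unfolding merge_step_def by blast
    obtain Ps where Ps: "Ps \<noteq> []" "hd Ps = ?Q" "card (last Ps) \<le> 1"
      "\<And>i. Suc i < length Ps \<Longrightarrow> merge_step (Ps ! i) (Ps ! Suc i)"
      using less.hyps[OF merge_step_card[OF step less.prems assms(2)]
          merge_step_partition_on[OF step less.prems]] by blast
    have "merge_step ((P # Ps) ! i) ((P # Ps) ! Suc i)" if "Suc i < length (P # Ps)" for i
      using that Ps step by (cases i) (auto simp: hd_conv_nth)
    then show ?thesis using Ps by (intro exI[of _ "P # Ps"]) auto
  qed
qed

lemma partition_sequence_partition_on:
  assumes "partition_sequence G Ps" and "i < length Ps"
  shows "partition_on (pverts G) (Ps ! i)"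
  using assms(2)
proof (induction i)
  case 0
  have "Ps ! 0 = (\<lambda>v. {v}) ` pverts G"
    using assms(1) unfolding partition_sequence_def by (metis hd_conv_nth)
  then show ?case using partition_on_singletons by simp
next
  case (Suc i)
  then show ?case using assms(1) merge_step_partition_on
    unfolding partition_sequence_def by (metis Suc_lessD)
qed

lemma twin_width_le_sequence:
  assumes fin: "finite (pverts G)" and "twin_width G \<le> w"
  obtains Ps where "partition_sequence G Ps"
    and "\<And>P A. P \<in> set Ps \<Longrightarrow> A \<in> P \<Longrightarrow> red_degree G P A \<le> w"
proof -
  have "\<exists>w Ps. partition_sequence G Ps \<and> sequence_width G Ps = w"
    using merge_steps_exist[OF partition_on_singletons fin] unfolding partition_sequence_def by blast
  then obtain Ps where Ps: "partition_sequence G Ps" "sequence_width G Ps = twin_width G"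
    unfolding twin_width_def using LeastI_ex[of "\<lambda>w. \<exists>Ps. partition_sequence G Ps \<and> sequence_width G Ps = w"]
    by auto
  have "red_degree G P A \<le> w" if "P \<in> set Ps" "A \<in> P" for P A
  proof -
    have "finite P" if "P \<in> set Ps" for P
      using that finite_elements[OF fin partition_sequence_partition_on[OF Ps(1)]]
      by (metis in_set_conv_nth)
    then have "red_degree G P A \<le> sequence_width G Ps"
      unfolding sequence_width_def using that by (intro Max_ge) auto
    then show ?thesis using Ps(2) assms(2) by simp
  qed
  with Ps(1) show ?thesis using that by blast
qed

section \<open>Red edges in partitions of red degree at most one\<close>

lemma red_degree_le_1_unique:
  assumes "red_degree G P A \<le> 1" and "finite P"
    and "B \<in> P" "red_edge G A B" and "C \<in> P" "red_edge G A C"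
  shows "B = C"
proof -
  have "finite {B \<in> P. red_edge G A B}" using assms(2) by simp
  then show ?thesis
    using assms card_le_Suc0_iff_eq[of "{B \<in> P. red_edge G A B}"] unfolding red_degree_def by auto
qed

lemma red_edge_mono:
  assumes "red_edge G A B" "A \<subseteq> A'" "B \<subseteq> B'" "A' \<noteq> B'"
  shows "red_edge G A' B'"
  using assms unfolding red_edge_def by blast

text \<open>Ends are compared as unordered pairs because in a graph \<open>red_edge\<close> relates
  them in both orders.\<close>

definition single_red_edge :: "'a pair_pre_digraph \<Rightarrow> 'a set set \<Rightarrow> bool" where
  "single_red_edge G P \<longleftrightarrow>
    (\<forall>A\<in>P. \<forall>B\<in>P. \<forall>C\<in>P. \<forall>D\<in>P. red_edge G A B \<longrightarrow> red_edge G C D \<longrightarrow> {A, B} = {C, D})"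

lemma single_red_edgeD:
  assumes "single_red_edge G P" "A \<in> P" "B \<in> P" "C \<in> P" "D \<in> P"
    and "red_edge G A B" "red_edge G C D"
  shows "{A, B} = {C, D}"
  by (rule assms(1)[unfolded single_red_edge_def, rule_format, OF assms(2-)])

context pair_graph
begin

lemma red_edge_sym: "red_edge G A B \<Longrightarrow> red_edge G B A"
  using arcs_symmetric unfolding red_edge_def by blast

text \<open>If no outside vertex told two elements of \<open>M\<close> apart, \<open>M\<close> would
  be a nontrivial module. The part containing such a vertex serves as \<open>B\<close>.\<close>

lemma prime_red_neighbour:
  assumes "prime_graph G" and P: "partition_on (pverts G) P"
    and M: "M \<in> P" "\<not> is_singleton M" "M \<noteq> pverts G"
  obtains B where "B \<in> P" "red_edge G M B"
proof -
  have "M \<noteq> {}" "M \<subseteq> pverts G" using M(1) P by (auto simp: partition_on_def)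
  then obtain v where v: "v \<in> pverts G - M"
    "\<not> (\<forall>m\<in>M. (v, m) \<in> parcs G)" "\<not> (\<forall>m\<in>M. (v, m) \<notin> parcs G)"
    using assms(1) M(2,3) unfolding prime_graph_def graph_module_def by blast
  obtain B where "B \<in> P" "v \<in> B" using v(1) partition_onD1[OF P] by blast
  moreover have "red_edge G M B"
    using v \<open>v \<in> B\<close> arcs_symmetric unfolding red_edge_def by blast
  ultimately show ?thesis using that by blast
qed

text \<open>Two red edges of \<open>P\<close> have no common end, since red degrees are at most one.
  If neither joins \<open>X\<close> to \<open>Y\<close>, both survive the merge, and one merge
  cannot identify two disjoint pairs of parts. If one joins \<open>X\<close> to \<open>Y\<close>,
  the other survives beside a red edge at \<open>X \<union> Y\<close> that primality supplies.
  Either way \<open>Q\<close> has two red edges.\<close>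

lemma single_red_edge_step:
  assumes prime: "prime_graph G" and P: "partition_on (pverts G) P"
    and step: "merge_step P Q" and width: "\<And>A. A \<in> P \<Longrightarrow> red_degree G P A \<le> 1"
    and Q1: "single_red_edge G Q"
  shows "single_red_edge G P"
proof -
  obtain X Y where XY: "X \<in> P" "Y \<in> P" "X \<noteq> Y" and Q: "Q = insert (X \<union> Y) (P - {X, Y})"
    using step by (rule merge_stepE)
  have fin: "finite P" using finite_elements[OF pair_finite_verts P] .
  have Qp: "partition_on (pverts G) Q" using merge_step_partition_on[OF step P] .
  have disj: "A \<inter> B = {}" if "A \<in> P" "B \<in> P" "A \<noteq> B" for A B
    using partition_onD2[OF P] that by (auto simp: disjoint_def)
  have ne: "A \<noteq> {}" if "A \<in> P" for A using partition_onD3[OF P] that by auto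
  have sub: "A \<subseteq> pverts G" if "A \<in> P" for A using partition_onD1[OF P] that by auto
  \<comment> \<open>The merge does not touch \<open>C\<close> and \<open>D\<close>, so their red
    edge is also one of \<open>Q\<close>. Primality gives \<open>X \<union> Y\<close> a red edge of
    its own, contradicting \<open>Q1\<close>.\<close>
  have no_merge: False
    if "C \<in> P" "D \<in> P" "red_edge G C D" "X \<notin> {C, D}" "Y \<notin> {C, D}" for C D
  proof -
    have CD: "C \<in> Q" "D \<in> Q" using that Q by auto
    have "\<not> is_singleton (X \<union> Y)" using union_of_parts_not_singleton[OF P XY] .
    moreover have "X \<union> Y \<noteq> pverts G"
    proof -
      have "C \<inter> (X \<union> Y) = {}"
        using disj[OF that(1) XY(1)] disj[OF that(1) XY(2)] that(4,5) by auto
      then show ?thesis using ne[OF that(1)] sub[OF that(1)] by auto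
    qed
    moreover have XYQ: "X \<union> Y \<in> Q" using Q by simp
    ultimately obtain Z where "Z \<in> Q" "red_edge G (X \<union> Y) Z"
      using prime_red_neighbour[OF prime Qp] by metis
    then have "{X \<union> Y, Z} = {C, D}"
      using single_red_edgeD[OF Q1 XYQ _ CD _ that(3)] by simp
    moreover have "X \<union> Y \<noteq> C" "X \<union> Y \<noteq> D"
      using disj[OF XY(1) that(1)] disj[OF XY(1) that(2)] ne[OF XY(1)] that(4) by auto
    ultimately show False by (auto simp: doubleton_eq_iff)
  qed
  have "{A, B} = {C, D}"
    if in_P: "A \<in> P" "B \<in> P" "C \<in> P" "D \<in> P" and red: "red_edge G A B" "red_edge G C D" for A B C D
  proof (rule ccontr)
    assume neq: "{A, B} \<noteq> {C, D}"
    have uniq: "T = U" if "S \<in> P" "T \<in> P" "U \<in> P" "red_edge G S T" "red_edge G S U" for S T U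
      using red_degree_le_1_unique[OF width fin] that by blast
    have dist: "A \<noteq> B" "C \<noteq> D" using red unfolding red_edge_def by auto
    have dist': "A \<noteq> C" "A \<noteq> D" "B \<noteq> C" "B \<noteq> D"
      using uniq[OF in_P(1,2,4) red(1)] uniq[OF in_P(1,2,3) red(1)]
        uniq[OF in_P(2,1,4) red_edge_sym[OF red(1)]] uniq[OF in_P(2,1,3) red_edge_sym[OF red(1)]]
        red(2) red_edge_sym[OF red(2)] neq by (metis insert_commute)+
    \<comment> \<open>For \<open>S\<close> in \<open>P\<close>, \<open>m S\<close> is the part of
      \<open>Q\<close> that contains \<open>S\<close>.\<close>
    define m where "m S = (if S \<in> {X, Y} then X \<union> Y else S)" for S
    have m_sub: "S \<subseteq> m S" for S unfolding m_def by auto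
    have m_Q: "m S \<in> Q" if "S \<in> P" for S using that unfolding m_def Q by auto
    have XY_not: "X \<union> Y \<noteq> S" if "S \<in> P - {X, Y}" for S
      using disj[OF XY(1), of S] ne[OF XY(1)] that by auto
    have m_inj: "S = T \<or> {S, T} = {X, Y}" if "m S = m T" "S \<in> P" "T \<in> P" for S T
    proof -
      have "S \<in> {X, Y} \<longleftrightarrow> T \<in> {X, Y}"
        using that XY_not[of S] XY_not[of T] unfolding m_def
        by (metis (no_types, lifting) DiffI)
      then show ?thesis using that(1) unfolding m_def by (cases "S \<in> {X, Y}") auto
    qed
    show False
    proof (cases "{A, B} = {X, Y} \<or> {C, D} = {X, Y}")
      case True
      then show False
      proof
        assume "{A, B} = {X, Y}"
        then have "X \<in> {A, B}" "Y \<in> {A, B}" by simp_all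
        then show False using no_merge[OF in_P(3,4) red(2)] dist' by (metis insert_iff singletonD)
      next
        assume "{C, D} = {X, Y}"
        then have "X \<in> {C, D}" "Y \<in> {C, D}" by simp_all
        then show False using no_merge[OF in_P(1,2) red(1)] dist' by (metis insert_iff singletonD)
      qed
    next
      case False
      then have "m A \<noteq> m B" "m C \<noteq> m D" 
        using m_inj[OF _ in_P(1,2)] m_inj[OF _ in_P(3,4)] dist by metis+
      then have "red_edge G (m A) (m B)" "red_edge G (m C) (m D)"
        using red_edge_mono[OF red(1) m_sub m_sub] red_edge_mono[OF red(2) m_sub m_sub] by blast+
      then have "{m A, m B} = {m C, m D}"
        by (rule single_red_edgeD[OF Q1 in_P[THEN m_Q]])
      then have "(m A = m C \<and> m B = m D) \<or> (m A = m D \<and> m B = m C)"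
        unfolding doubleton_eq_iff .
      then show False
      proof
        assume "m A = m C \<and> m B = m D"
        then have "{A, C} = {X, Y}" "{B, D} = {X, Y}"
          using m_inj[of A C] m_inj[of B D] in_P dist' by simp_all
        then show False using dist dist' by (metis doubleton_eq_iff)
      next
        assume "m A = m D \<and> m B = m C"
        then have "{A, D} = {X, Y}" "{B, C} = {X, Y}"
          using m_inj[of A D] m_inj[of B C] in_P dist' by simp_all
        then show False using dist dist' by (metis doubleton_eq_iff)
      qed
    qed
  qed
  then show ?thesis unfolding single_red_edge_def by blast
qed

text \<open>Downward induction from the last partition, which has at most one part and therefore no
  red edge.\<close>

lemma single_red_edge_sequence:
  assumes "prime_graph G" and seq: "partition_sequence G Ps"
    and "\<And>P A. P \<in> set Ps \<Longrightarrow> A \<in> P \<Longrightarrow> red_degree G P A \<le> 1"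
    and "i < length Ps"
  shows "single_red_edge G (Ps ! i)"
proof -
  define n where "n = length Ps - 1"
  have n: "n < length Ps" "Ps ! n = last Ps"
    using seq unfolding n_def partition_sequence_def by (auto simp: last_conv_nth)
  have "i \<le> n" using assms(4) n_def by simp
  then show ?thesis
  proof (induction rule: inc_induct)
    case base
    have "finite (last Ps)"
      using finite_elements[OF pair_finite_verts partition_sequence_partition_on[OF seq n(1)]] n(2)
      by simp
    then have "A = B" if "A \<in> last Ps" "B \<in> last Ps" for A B
      using seq that card_le_Suc0_iff_eq[of "last Ps"] unfolding partition_sequence_def by auto
    then have "\<not> red_edge G A B" if "A \<in> last Ps" "B \<in> last Ps" for A B
      using that unfolding red_edge_def by metis
    then show ?case unfolding single_red_edge_def n(2) by simp
  next
    case (step j)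
    then have j: "Suc j < length Ps" using n(1) by simp
    then have "merge_step (Ps ! j) (Ps ! Suc j)"
      using seq unfolding partition_sequence_def by blast
    moreover have "red_degree G (Ps ! j) A \<le> 1" if "A \<in> Ps ! j" for A
      using assms(3)[OF nth_mem that] j by simp
    ultimately show ?case
      by (rule single_red_edge_step[OF assms(1)
            partition_sequence_partition_on[OF seq Suc_lessD[OF j]] _ _ step.IH])
  qed
qed

end

section \<open>Equitable colorings of prime graphs of twin-width one\<close>

text \<open>Stability under color refinement. Counting neighbours in a set \<open>S\<close> of
  colors instead of a single color lets unions of color classes be used at once.\<close>

locale equitable_coloring = pair_graph G for G :: "'a pair_pre_digraph" +
  fixes col :: "'a \<Rightarrow> 'c"
  assumes equitable: "\<lbrakk>w \<in> pverts G; w' \<in> pverts G; col w = col w'\<rbrakk> \<Longrightarrow>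
    card {u \<in> pverts G. col u \<in> S \<and> (w, u) \<in> parcs G} =
    card {u \<in> pverts G. col u \<in> S \<and> (w', u) \<in> parcs G}"
begin

section \<open>Vertices identified by their color\<close>

definition uniquely_colored :: "'a \<Rightarrow> bool" where
  "uniquely_colored v \<longleftrightarrow> (\<forall>u\<in>pverts G. col u = col v \<longrightarrow> u = v)"

text \<open>With \<open>S = {col x}\<close> the counted neighbours number one or zero according to
  adjacency to \<open>x\<close>.\<close>

lemma adjacent_uniquely_colored:
  assumes "uniquely_colored x" "x \<in> pverts G" "w \<in> pverts G" "w' \<in> pverts G" "col w = col w'"
  shows "(w, x) \<in> parcs G \<longleftrightarrow> (w', x) \<in> parcs G"
proof -
  have "{u \<in> pverts G. col u \<in> {col x} \<and> (w, u) \<in> parcs G} = (if (w, x) \<in> parcs G then {x} else {})" for w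
    using assms(1,2) unfolding uniquely_colored_def by auto
  then show ?thesis using equitable[OF assms(3-5), of "{col x}"] by (auto split: if_splits)
qed

text \<open>
  A vertex \<open>v'\<close> colored like \<open>v\<close> has as many neighbours as \<open>v\<close> among the neighbours and among the
  non-neighbours of \<open>x\<close> outside \<open>D\<close>. These numbers are extremal, so \<open>v\<close> and \<open>v'\<close> are twins.
\<close>

lemma uniquely_colored_by_agreement:
  assumes prime: "prime_graph G"
    and D: "D \<subseteq> pverts G" "\<And>x. x \<in> D \<Longrightarrow> uniquely_colored x"
    and x: "x \<in> D" and v: "v \<in> pverts G" "v \<notin> D"
    and agree: "\<And>u. u \<in> pverts G \<Longrightarrow> u \<notin> D \<Longrightarrow> u \<noteq> v \<Longrightarrow> (u, v) \<in> parcs G \<longleftrightarrow> (u, x) \<in> parcs G"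
  shows "uniquely_colored v"
  unfolding uniquely_colored_def
proof (intro ballI impI)
  fix v' assume v': "v' \<in> pverts G" "col v' = col v"
  show "v' = v"
  proof (rule ccontr)
    assume ne: "v' \<noteq> v"
    have fin: "finite (pverts G)" by (rule pair_finite_verts)
    have sym: "(p, q) \<in> parcs G \<longleftrightarrow> (q, p) \<in> parcs G" for p q using arcs_symmetric by blast
    have x_V: "x \<in> pverts G" using x D by auto
    have color_x: "(u, x) \<in> parcs G \<longleftrightarrow> (u', x) \<in> parcs G"
      if "u \<in> pverts G" "u' \<in> pverts G" "col u = col u'" for u u'
      using adjacent_uniquely_colored[OF D(2)[OF x] x_V] that by blast
    have color_D: "u \<in> D \<longleftrightarrow> u' \<in> D" if "u \<in> pverts G" "u' \<in> pverts G" "col u = col u'" for u u'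
      using D(2) that unfolding uniquely_colored_def by metis
    have v'D: "v' \<notin> D" using color_D v v' by blast
    \<comment> \<open>\<open>N True\<close> and \<open>N False\<close> split the vertices outside
      \<open>D\<close> by adjacency to \<open>x\<close>. Both are unions of color classes, as a
      color determines membership in \<open>D\<close> and adjacency to \<open>x\<close>; hence
      \<open>equitable\<close> counts neighbours inside them.\<close>
    define N where "N b = {u \<in> pverts G - D. (u, x) \<in> parcs G \<longleftrightarrow> b}" for b
    have N_col: "{u \<in> pverts G. col u \<in> col ` N b \<and> (w, u) \<in> parcs G} = {u \<in> N b. (w, u) \<in> parcs G}"
      for b w
      using color_x color_D unfolding N_def by (auto simp: image_iff)
    have card_N: "card {u \<in> N b. (v, u) \<in> parcs G} = card {u \<in> N b. (v', u) \<in> parcs G}" for b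
      using equitable[OF v(1) v'(1) v'(2)[symmetric], of "col ` N b"] unfolding N_col .
    have fin_N: "finite (N b)" for b using fin unfolding N_def by simp
    have "{u \<in> N True. (v, u) \<in> parcs G} = N True - {v}"
      using agree sym no_loops' unfolding N_def by blast
    moreover have sub: "{u \<in> N True. (v', u) \<in> parcs G} \<subseteq> N True - {v'}"
      using no_loops' by blast
    moreover have "v \<in> N True \<longleftrightarrow> v' \<in> N True"
      using v v' v'D color_x[OF v'(1) v(1) v'(2)] unfolding N_def by simp
    then have "card (N True - {v}) = card (N True - {v'})"
      using fin_N by (cases "v \<in> N True") (auto simp: card_Diff_singleton)
    \<comment> \<open>\<open>v\<close> is adjacent to all of \<open>N True\<close> except itself.
      Both or neither of \<open>v\<close> and \<open>v'\<close> lie in it, so \<open>v'\<close>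
      attains the same maximum.\<close>
    ultimately have full: "{u \<in> N True. (v', u) \<in> parcs G} = N True - {v'}"
      using card_N[of True] fin_N by (intro card_subset_eq) auto
    have "{u \<in> N False. (v, u) \<in> parcs G} = {}"
      using agree sym no_loops' unfolding N_def by blast
    then have "card {u \<in> N False. (v', u) \<in> parcs G} = 0"
      using card_N[of False] by (metis card.empty)
    then have empty: "{u \<in> N False. (v', u) \<in> parcs G} = {}"
      using fin_N by simp
    have "(u, v) \<in> parcs G \<longleftrightarrow> (u, v') \<in> parcs G" if u: "u \<in> pverts G - {v, v'}" for u
    proof (cases "u \<in> D")
      case True
      then show ?thesis
        using adjacent_uniquely_colored[OF D(2), of u v v'] u v v' sym by auto
    next
      case False
      then have "(u, v') \<in> parcs G \<longleftrightarrow> (u, x) \<in> parcs G"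
        using full empty u sym unfolding N_def by blast
      then show ?thesis using agree False u by auto
    qed
    then have "graph_module G {v, v'}"
      using v v' unfolding graph_module_def by auto
    moreover have "\<not> is_singleton {v, v'}" using ne by (auto simp: is_singleton_def)
    moreover have "x \<notin> {v, v'}" using x v(2) v'D by auto
    then have "{v, v'} \<noteq> pverts G" using x_V by metis
    ultimately show False using prime unfolding prime_graph_def by blast
  qed
qed

text \<open>A vertex \<open>v'\<close> colored like \<open>v\<close> has the same neighbours in
  \<open>M\<close>, because the vertices of \<open>M\<close> are uniquely colored. Its part is then
  joined to \<open>M\<close> by a red edge too, so it must be \<open>{v}\<close>.\<close>

lemma uniquely_colored_red_neighbour:
  assumes P: "partition_on (pverts G) P" and width: "red_degree G P M \<le> 1"
    and M: "M \<in> P" "\<And>x. x \<in> M \<Longrightarrow> uniquely_colored x"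
    and v: "{v} \<in> P" "red_edge G M {v}"
  shows "uniquely_colored v"
  unfolding uniquely_colored_def
proof (intro ballI impI)
  fix v' assume v': "v' \<in> pverts G" "col v' = col v"
  have V: "v \<in> pverts G" "M \<subseteq> pverts G" using M v P by (auto simp: partition_on_def)
  have same: "(v', m) \<in> parcs G \<longleftrightarrow> (v, m) \<in> parcs G" if "m \<in> M" for m
    using adjacent_uniquely_colored[OF M(2)] that V v' by blast
  have "M \<noteq> {v}" using v(2) unfolding red_edge_def by simp
  then have "M \<inter> {v} = {}" using disjointD[OF partition_onD2[OF P] M(1) v(1)] by simp
  then have "v' \<notin> M" using M(2) v' V unfolding uniquely_colored_def by fastforce
  obtain B where B: "B \<in> P" "v' \<in> B" using partition_onD1[OF P] v' by blast
  have "\<not> (\<forall>m\<in>M. (v', m) \<in> parcs G)" "\<not> (\<forall>m\<in>M. (v', m) \<notin> parcs G)"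
    using v(2) same arcs_symmetric unfolding red_edge_def by blast+
  then have "red_edge G M B"
    using B \<open>v' \<notin> M\<close> arcs_symmetric unfolding red_edge_def by blast
  then have "B = {v}"
    using red_degree_le_1_unique[OF width finite_elements[OF pair_finite_verts P]] B v by blast
  then show "v' = v" using B by simp
qed

text \<open>Only \<open>X \<union> Y\<close> can be a new non-singleton part. Non-singletons among
  \<open>X\<close> and \<open>Y\<close> are covered by \<open>uniq\<close>. A single vertex joining
  a larger part is treated in \<open>half\<close>; if two singletons are merged, one of them is the
  red neighbour of \<open>M\<close>.\<close>

lemma uniquely_colored_step:
  assumes prime: "prime_graph G" and P: "partition_on (pverts G) P" and step: "merge_step P Q"
    and widthP: "\<And>A. A \<in> P \<Longrightarrow> red_degree G P A \<le> 1"
    and widthQ: "\<And>A. A \<in> Q \<Longrightarrow> red_degree G Q A \<le> 1"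
    and Q1: "single_red_edge G Q"
    and ex: "M \<in> P" "\<not> is_singleton M"
    and uniq: "\<And>M x. M \<in> P \<Longrightarrow> \<not> is_singleton M \<Longrightarrow> x \<in> M \<Longrightarrow> uniquely_colored x"
    and Z: "Z \<in> Q" "\<not> is_singleton Z" "z \<in> Z"
  shows "uniquely_colored z"
proof -
  obtain X Y where XY: "X \<in> P" "Y \<in> P" "X \<noteq> Y" and Q: "Q = insert (X \<union> Y) (P - {X, Y})"
    using step by (rule merge_stepE)
  have finQ: "finite Q"
    using finite_elements[OF pair_finite_verts merge_step_partition_on[OF step P]] .
  have Qp: "partition_on (pverts G) Q" using merge_step_partition_on[OF step P] .
  have disj: "A \<inter> B = {}" if "A \<in> P" "B \<in> P" "A \<noteq> B" for A B
    using partition_onD2[OF P] that by (auto simp: disjoint_def)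
  have ne: "A \<noteq> {}" if "A \<in> P" for A using partition_onD3[OF P] that by auto
  have sub: "A \<subseteq> pverts G" if "A \<in> P" for A using partition_onD1[OF P] that by auto
  have red_uniq: "uniquely_colored x"
    if "A \<in> P" "\<not> is_singleton A" "B \<in> P" "red_edge G A B" "x \<in> B" for A B x
  proof (cases "is_singleton B")
    case True
    then have "B = {x}" using that(5) by (auto simp: is_singleton_def)
    then show ?thesis
      using uniquely_colored_red_neighbour[OF P widthP] that uniq by blast
  qed (use uniq that in blast)
  \<comment> \<open>The red edge from \<open>A\<close> to \<open>B\<close> persists at
    \<open>A \<union> {v}\<close> and exhausts its red degree in \<open>Q\<close>. Every other part
    is thus homogeneous to \<open>A \<union> {v}\<close>, so \<open>v\<close> and any
    \<open>x \<in> A\<close> agree outside \<open>A \<union> B\<close>, which serves as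
    \<open>D\<close>.\<close>
  have extend: "uniquely_colored v"
    if A: "A \<in> P" and B: "B \<in> P" and v: "{v} \<in> P" and dist: "A \<noteq> {v}" "B \<noteq> {v}"
      and merged: "{X, Y} = {A, {v}}" and AB: "red_edge G A B"
      and uA: "\<And>x. x \<in> A \<Longrightarrow> uniquely_colored x" and uB: "\<And>x. x \<in> B \<Longrightarrow> uniquely_colored x"
    for A B v
  proof -
    have "X \<union> Y = A \<union> {v}" using merged by (auto simp: doubleton_eq_iff)
    then have Q': "Q = insert (A \<union> {v}) (P - {A, {v}})" using Q merged by simp
    have "A \<noteq> B" using AB unfolding red_edge_def by auto
    then have BQ: "B \<in> Q" using B dist Q' by auto
    have "A \<union> {v} \<noteq> B" using disj[OF B v dist(2)] by auto
    then have redB: "red_edge G (A \<union> {v}) B" by (intro red_edge_mono[OF AB]) auto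
    obtain x where x: "x \<in> A" using ne[OF A] by blast
    have vnot: "v \<notin> A \<union> B" using disj[OF A v dist(1)] disj[OF B v dist(2)] by auto
    have agree: "(u, v) \<in> parcs G \<longleftrightarrow> (u, x) \<in> parcs G"
      if u: "u \<in> pverts G" "u \<notin> A \<union> B" "u \<noteq> v" for u
    proof -
      obtain C where C: "C \<in> P" "u \<in> C" using partition_onD1[OF P] u by blast
      then have "C \<in> Q" "C \<noteq> B" "C \<noteq> A \<union> {v}" using u Q' by auto
      then have "\<not> red_edge G (A \<union> {v}) C"
        using red_degree_le_1_unique[OF widthQ finQ BQ redB] Q' by blast
      then show ?thesis
        using C(2) x \<open>C \<noteq> A \<union> {v}\<close> arcs_symmetric unfolding red_edge_def by blast
    qed
    show ?thesis
    proof (rule uniquely_colored_by_agreement[OF prime _ _ _ _ vnot agree])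
      show "A \<union> B \<subseteq> pverts G" "v \<in> pverts G" using sub[OF A] sub[OF B] sub[OF v] by auto
      show "uniquely_colored y" if "y \<in> A \<union> B" for y using that uA uB by auto
      show "x \<in> A \<union> B" using x by simp
    qed
  qed
  have half: "uniquely_colored v"
    if A: "A \<in> P" "\<not> is_singleton A" and v: "{v} \<in> P" and merged: "{X, Y} = {A, {v}}" for A v
  proof -
    have dist: "A \<noteq> {v}" using A by auto
    have "A \<noteq> pverts G" using disj[OF A(1) v dist] sub[OF v] by auto
    then obtain B where B: "B \<in> P" "red_edge G A B"
      using prime_red_neighbour[OF prime P A] by blast
    show ?thesis
    proof (cases "B = {v}")
      case True
      then show ?thesis using red_uniq A B by blast
    next
      case False
      then show ?thesis
        using extend[OF A(1) B(1) v dist False merged B(2) uniq[OF A] red_uniq[OF A B]] by blast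
    qed
  qed
  show ?thesis
  proof (cases "Z \<in> P")
    case True
    then show ?thesis using uniq Z by blast
  next
    case False
    then have Z_eq: "Z = X \<union> Y" using Z(1) Q by auto
    show ?thesis
    proof (cases "is_singleton X \<and> is_singleton Y")
      case False
      \<comment> \<open>\<open>A\<close> stands for a non-singleton among \<open>X\<close> and
        \<open>Y\<close>, and \<open>B\<close> for the other one.\<close>
      have "uniquely_colored z" if "A \<in> P" "B \<in> P" "{X, Y} = {A, B}" "\<not> is_singleton A" "z \<in> B" for A B
        using half[of A z] uniq[of B z] that by (cases "is_singleton B") (auto simp: is_singleton_def)
      then show ?thesis using False uniq[of X z] uniq[of Y z] XY Z(3) Z_eq
        by (metis Un_iff insert_commute)
    next
      case True
      then obtain u v where uv: "X = {u}" "Y = {v}" by (auto simp: is_singleton_def)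
      have MXY: "M \<noteq> X" "M \<noteq> Y" using True ex by auto
      then have "M \<noteq> pverts G" using disj[OF ex(1) XY(1)] sub[OF XY(1)] ne[OF XY(1)] by auto
      then obtain B where B: "B \<in> P" "red_edge G M B"
        using prime_red_neighbour[OF prime P ex] by blast
      \<comment> \<open>Otherwise the red edge from \<open>M\<close> to \<open>B\<close> would
        survive in \<open>Q\<close> next to a red edge at \<open>Z\<close>.\<close>
      have "B \<in> {X, Y}"
      proof (rule ccontr)
        assume BXY: "B \<notin> {X, Y}"
        have MB: "M \<in> Q" "B \<in> Q" using ex B MXY BXY Q by auto
        have "X \<union> Y \<noteq> pverts G"
          using disj[OF ex(1) XY(1) MXY(1)] disj[OF ex(1) XY(2) MXY(2)] ne[OF ex(1)] sub[OF ex(1)] by blast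
        then obtain W where "W \<in> Q" "red_edge G Z W"
          using prime_red_neighbour[OF prime Qp Z(1,2)] Z_eq by blast
        then have "{Z, W} = {M, B}"
          using single_red_edgeD[OF Q1 Z(1) _ MB _ B(2)] by simp
        then show False using \<open>Z \<notin> P\<close> ex B by (auto simp: doubleton_eq_iff)
      qed
      then obtain p q where pq: "B = {p}" "{X, Y} = {{p}, {q}}" "p \<noteq> q" "{p} \<in> P" "{q} \<in> P"
        using uv XY by blast
      have up: "uniquely_colored p" using red_uniq[OF ex B] pq(1) by blast
      \<comment> \<open>\<open>extend\<close> is used with \<open>{p}\<close> as \<open>A\<close>
        and \<open>M\<close> as \<open>B\<close>: \<open>{p}\<close> is red to \<open>M\<close>,
        already identified, and merged with \<open>{q}\<close>.\<close>
      have "M \<noteq> {q}" using ex by auto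
      then have "uniquely_colored q"
        using extend[OF pq(4) ex(1) pq(5) _ _ pq(2) _ _ uniq[OF ex]] pq(1,3) red_edge_sym[OF B(2)] up
        by auto
      moreover have "z = p \<or> z = q" using Z(3) Z_eq pq(2) uv by (auto simp: doubleton_eq_iff)
      ultimately show ?thesis using up by blast
    qed
  qed
qed

text \<open>Upward induction along \<open>Ps\<close> by \<open>uniquely_colored_step\<close>. The
  part left at the end contains every vertex, so unique colors there amount to injectivity.\<close>

lemma inj_on_if_sequence:
  assumes prime: "prime_graph G" and seq: "partition_sequence G Ps"
    and width: "\<And>P A. P \<in> set Ps \<Longrightarrow> A \<in> P \<Longrightarrow> red_degree G P A \<le> 1"
    and first: "\<And>M x. Suc 0 < length Ps \<Longrightarrow> M \<in> Ps ! Suc 0 \<Longrightarrow> \<not> is_singleton M \<Longrightarrow> x \<in> M \<Longrightarrow>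
      uniquely_colored x"
  shows "inj_on col (pverts G)"
proof -
  define n where "n = length Ps - 1"
  have n: "n < length Ps" "Ps ! n = last Ps"
    using seq unfolding n_def partition_sequence_def by (auto simp: last_conv_nth)
  have steps: "merge_step (Ps ! i) (Ps ! Suc i)" if "Suc i < length Ps" for i
    using seq that unfolding partition_sequence_def by blast
  have part: "partition_on (pverts G) (Ps ! i)" if "i < length Ps" for i
    using partition_sequence_partition_on[OF seq that] .
  have nonsingleton: "\<exists>M\<in>Ps ! Suc i. \<not> is_singleton M" if "Suc i < length Ps" for i
    using steps[OF that] union_of_parts_not_singleton[OF part[OF Suc_lessD[OF that]]]
    by (metis insertI1 merge_stepE)
  have one_part: "A = B" if "A \<in> Ps ! n" "B \<in> Ps ! n" for A B
    using that seq card_le_Suc0_iff_eq[OF finite_elements[OF pair_finite_verts part[OF n(1)]]] n(2)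
    unfolding partition_sequence_def by auto
  show ?thesis
  proof (cases "n = 0")
    \<comment> \<open>Without a merge the initial partition is already the last, so there is at most
      one vertex.\<close>
    case True
    then have "(\<lambda>v. {v}) ` pverts G = Ps ! n"
      using seq unfolding partition_sequence_def by (metis hd_conv_nth)
    then have "v = w" if "v \<in> pverts G" "w \<in> pverts G" for v w
      using one_part[of "{v}" "{w}"] that by blast
    then show ?thesis by (auto intro: inj_onI)
  next
    case False
    \<comment> \<open>The induction starts at index \<open>Suc 0\<close>: the initial partition
      consists of singletons, while the step requires a non-singleton part.\<close>
    then have "Suc 0 \<le> n" by simp
    then have "n < length Ps \<longrightarrow> (\<forall>M\<in>Ps ! n. \<not> is_singleton M \<longrightarrow> (\<forall>x\<in>M. uniquely_colored x))"
    proof (induction rule: dec_induct)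
      case base
      then show ?case using first by blast
    next
      case (step i)
      show ?case
      proof (intro impI ballI)
        fix Z z
        assume len: "Suc i < length Ps" and Z: "Z \<in> Ps ! Suc i" "\<not> is_singleton Z" "z \<in> Z"
        obtain M where M: "M \<in> Ps ! i" "\<not> is_singleton M"
          using nonsingleton[of "i - 1"] step.hyps len by auto
        show "uniquely_colored z"
        proof (rule uniquely_colored_step[OF prime part[OF Suc_lessD[OF len]] steps[OF len]])
          show "single_red_edge G (Ps ! Suc i)"
            using single_red_edge_sequence[OF prime seq width len] .
        qed (use step.IH len width M Z in auto)
      qed
    qed
    moreover obtain M where "M \<in> Ps ! n" "\<not> is_singleton M"
      using nonsingleton[of "n - 1"] False n(1) by auto
    moreover have "M = pverts G"
      using one_part calculation(2) partition_onD1[OF part[OF n(1)]] by blast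
    ultimately show ?thesis
      using n(1) unfolding uniquely_colored_def by (metis inj_onI)
  qed
qed

end

text \<open>\<open>a\<close> and \<open>b\<close> are the vertices merged first. They are read off
  the sequence, so one pair works for all colorings \<open>col\<close>. If there is no merge,
  arbitrary vertices serve.\<close>

lemma (in pair_graph) twin_width_one_individualization:
  assumes prime: "prime_graph G" and tw: "twin_width G \<le> 1" and nonempty: "pverts G \<noteq> {}"
  obtains a b where "a \<in> pverts G" "b \<in> pverts G"
    "\<And>col :: 'a \<Rightarrow> 'c. equitable_coloring G col \<Longrightarrow> equitable_coloring.uniquely_colored G col a \<Longrightarrow>
      equitable_coloring.uniquely_colored G col b \<Longrightarrow> inj_on col (pverts G)"
proof -
  obtain Ps where seq: "partition_sequence G Ps"
    and width: "\<And>P A. P \<in> set Ps \<Longrightarrow> A \<in> P \<Longrightarrow> red_degree G P A \<le> 1"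
    using twin_width_le_sequence[OF pair_finite_verts tw] by metis
  have "\<exists>a\<in>pverts G. \<exists>b\<in>pverts G. \<forall>M. Suc 0 < length Ps \<longrightarrow> M \<in> Ps ! Suc 0 \<longrightarrow>
    \<not> is_singleton M \<longrightarrow> M = {a, b}"
  proof (cases "Suc 0 < length Ps")
    case True
    have Ps0: "Ps ! 0 = (\<lambda>v. {v}) ` pverts G"
      using seq unfolding partition_sequence_def by (metis hd_conv_nth)
    have "merge_step (Ps ! 0) (Ps ! Suc 0)"
      using seq True unfolding partition_sequence_def by blast
    then obtain X Y where XY: "X \<in> Ps ! 0" "Y \<in> Ps ! 0"
      and Ps1: "Ps ! Suc 0 = insert (X \<union> Y) (Ps ! 0 - {X, Y})"
      by (rule merge_stepE)
    obtain a b where "a \<in> pverts G" "b \<in> pverts G" "X = {a}" "Y = {b}" 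
      using XY[unfolded Ps0] by blast
    moreover from this have "M = {a, b}" if "M \<in> Ps ! Suc 0" "\<not> is_singleton M" for M
      using that Ps0 Ps1 by auto
    ultimately show ?thesis by blast
  qed (use nonempty in auto)
  then obtain a b where ab: "a \<in> pverts G" "b \<in> pverts G"
    and first: "\<And>M. Suc 0 < length Ps \<Longrightarrow> M \<in> Ps ! Suc 0 \<Longrightarrow> \<not> is_singleton M \<Longrightarrow> M = {a, b}"
    by blast
  have "inj_on col (pverts G)"
    if "equitable_coloring G col" "equitable_coloring.uniquely_colored G col a"
      "equitable_coloring.uniquely_colored G col b" for col :: "'a \<Rightarrow> 'c"
    using equitable_coloring.inj_on_if_sequence[OF that(1) prime seq width] first that(2,3)
    by blast
  with ab show ?thesis using that by blast
qed

section \<open>The Weisfeiler-Leman coloring\<close>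

lemma wl_eq_imp_atp_eq: "wl k G c i vs = wl k H d i ws \<Longrightarrow> atp G c vs = atp H d ws"
  by (induction i) auto

lemma finite_vertex_tuples: "finite (pverts G) \<Longrightarrow> finite (vertex_tuples k G)"
  using finite_lists_length_eq[of "pverts G" k] unfolding vertex_tuples_def by (simp add: conj_commute)

lemma wl_joint_Suc_eq_imp_eq:
  "wl_joint k G c H d (Suc i) x = wl_joint k G c H d (Suc i) y \<Longrightarrow>
    wl_joint k G c H d i x = wl_joint k G c H d i y"
  unfolding wl_joint_def by (auto split: sum.splits)

lemma wl_stableD:
  assumes "wl_stable k G c H d i"
    and "x \<in> vertex_tuples k G <+> vertex_tuples k H" "y \<in> vertex_tuples k G <+> vertex_tuples k H"
    and "wl_joint k G c H d i x = wl_joint k G c H d i y"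
  shows "wl_joint k G c H d (Suc i) x = wl_joint k G c H d (Suc i) y"
  by (rule assms(1)[unfolded wl_stable_def, rule_format, OF assms(2-)])

text \<open>The relations \<open>R i\<close> of equal color on the disjoint union of the tuple sets
  are finite and decrease with \<open>i\<close>, strictly so after a round that is not stable. Hence
  a stable round exists and the \<open>LEAST\<close> is one.\<close>

lemma wl_stable_stable_round:
  fixes G :: "'a pair_pre_digraph" and H :: "'b pair_pre_digraph"
  assumes "finite (pverts G)" and "finite (pverts H)"
  shows "wl_stable k G c H d (wl_stable_round k G c H d)"
proof -
  define T where "T = vertex_tuples k G <+> vertex_tuples k H"
  define R where "R i = {(x, y) \<in> T \<times> T. wl_joint k G c H d i x = wl_joint k G c H d i y}" for i
  have fin: "finite (R i)" for i
  proof (rule finite_subset)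
    show "R i \<subseteq> T \<times> T" unfolding R_def by blast
    show "finite (T \<times> T)"
      unfolding T_def using assms[THEN finite_vertex_tuples]
      by (intro finite_cartesian_product finite_Plus)
  qed
  have "\<exists>i. wl_stable k G c H d i"
  proof (rule ccontr)
    assume "\<nexists>i. wl_stable k G c H d i"
    then have "\<not> R i \<subseteq> R (Suc i)" for i
      unfolding wl_stable_def R_def T_def by blast
    moreover have "R (Suc i) \<subseteq> R i" for i
      unfolding R_def using wl_joint_Suc_eq_imp_eq by blast
    ultimately have less: "card (R (Suc i)) < card (R i)" for i
      using fin by (metis psubset_card_mono psubsetI subset_refl)
    have "card (R i) + i \<le> card (R 0)" for i
    proof (induction i)
      case (Suc i)
      then show ?case using less[of i] by linarith
    qed simp
    from this[of "Suc (card (R 0))"] show False by simp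
  qed
  then show ?thesis unfolding wl_stable_round_def by (metis LeastI_ex)
qed

text \<open>Replacing the third entry leaves \<open>a\<close> and \<open>b\<close> fixed, so a round
  on triples \<open>[a, b, w]\<close> contains the data of color refinement with these two vertices
  individualized.\<close>

lemma wl_3_Suc_eq:
  assumes "wl 3 G c (Suc i) [a, b, w] = wl 3 H d (Suc i) [a', b', w']"
  shows "{#(atp G c [a, b, w, u], wl 3 G c i [a, b, u]). u \<in># mset_set (pverts G)#} =
    {#(atp H d [a', b', w', u], wl 3 H d i [a', b', u]). u \<in># mset_set (pverts H)#}"
    (is "?L = ?R")
proof -
  have "{#(atp G c ([a, b, w] @ [u]), map (\<lambda>j. wl 3 G c i ([a, b, w][j := u])) [0..<3]).
      u \<in># mset_set (pverts G)#} =
    {#(atp H d ([a', b', w'] @ [u]), map (\<lambda>j. wl 3 H d i ([a', b', w'][j := u])) [0..<3]).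
      u \<in># mset_set (pverts H)#}" (is "?L' = ?R'")
    using assms by simp
  \<comment> \<open>Index \<open>2\<close> picks the color after replacing the third entry; the
    other two colors are forgotten.\<close>
  then have "image_mset (\<lambda>(t, cs). (t, cs ! 2)) ?L' = image_mset (\<lambda>(t, cs). (t, cs ! 2)) ?R'"
    by (rule arg_cong)
  then show ?thesis by (simp add: image_mset.compositionality comp_def)
qed

lemma card_filter_eq_if_image_mset_eq:
  assumes "image_mset f (mset_set A) = image_mset g (mset_set B)" and "finite A" "finite B"
  shows "card {x \<in> A. P (f x)} = card {x \<in> B. P (g x)}"
proof -
  have "size (filter_mset P (image_mset f (mset_set A))) =
    size (filter_mset P (image_mset g (mset_set B)))"
    using assms(1) by simp
  then show ?thesis using assms(2,3) by (simp add: filter_mset_image_mset)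
qed

lemma (in pair_graph) equitable_coloring_wl:
  assumes stable: "\<And>vs ws. vs \<in> vertex_tuples 3 G \<Longrightarrow> ws \<in> vertex_tuples 3 G \<Longrightarrow>
      wl 3 G c i vs = wl 3 G c i ws \<Longrightarrow> wl 3 G c (Suc i) vs = wl 3 G c (Suc i) ws"
    and ab: "a \<in> pverts G" "b \<in> pverts G"
  shows "equitable_coloring G (\<lambda>w. wl 3 G c i [a, b, w])"
proof unfold_locales
  fix w w' S
  assume w: "w \<in> pverts G" "w' \<in> pverts G" "wl 3 G c i [a, b, w] = wl 3 G c i [a, b, w']"
  then have "wl 3 G c (Suc i) [a, b, w] = wl 3 G c (Suc i) [a, b, w']"
    using ab by (intro stable) (auto simp: vertex_tuples_def)
  \<comment> \<open>Positions \<open>2\<close> and \<open>3\<close> of \<open>[a, b, w, u]\<close>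
    hold \<open>w\<close> and \<open>u\<close>, and the last component of an atomic type records
    adjacency.\<close>
  from card_filter_eq_if_image_mset_eq[OF wl_3_Suc_eq[OF this] pair_finite_verts pair_finite_verts,
      of "\<lambda>(t, q). q \<in> S \<and> (2, 3) \<in> snd (snd t)"]
  show "card {u \<in> pverts G. wl 3 G c i [a, b, u] \<in> S \<and> (w, u) \<in> parcs G} =
    card {u \<in> pverts G. wl 3 G c i [a, b, u] \<in> S \<and> (w', u) \<in> parcs G}"
    by (simp add: atp_def)
qed

text \<open>The equality pattern in the atomic type tells whether the third entry equals the first
  or the second.\<close>

lemma wl_individualized_unique:
  assumes "wl 3 G c i [a, b, w] = wl 3 G c i [a, b, v]" and "v = a \<or> v = b"
  shows "w = v"
proof -
  have "(j, 2) \<in> fst (snd (atp G c [a, b, w])) \<longleftrightarrow> (j, 2) \<in> fst (snd (atp G c [a, b, v]))" for j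
    using wl_eq_imp_atp_eq[OF assms(1)] by simp
  from this[of 0] this[of 1] show ?thesis using assms(2) by (auto simp: atp_def)
qed

section \<open>From equal color multiplicities to a colored isomorphism\<close>

theorem theorem4p6:
  fixes G :: "'a pair_pre_digraph" and c :: "'a \<Rightarrow> nat"
    and H :: "'b pair_pre_digraph" and d :: "'b \<Rightarrow> nat"
  assumes "pair_graph G" and "pair_graph H"
    and "prime_graph G" and "prime_graph H"
    and "twin_width G \<le> 1" and "twin_width H \<le> 1"
    and "\<not> colored_iso G c H d"
  shows "wl_distinguishes 3 G c H d"
proof (rule ccontr)
  assume not_dist: "\<not> wl_distinguishes 3 G c H d"
  interpret G: pair_graph G by fact
  interpret H: pair_graph H by fact
  note fin = G.pair_finite_verts H.pair_finite_verts
  define s where "s = wl_stable_round 3 G c H d"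
  have card_eq: "card {vs \<in> vertex_tuples 3 G. wl 3 G c s vs = q} =
      card {vs \<in> vertex_tuples 3 H. wl 3 H d s vs = q}" for q
    using not_dist unfolding wl_distinguishes_def s_def Let_def by blast
  have stable: "wl_stable 3 G c H d s"
    unfolding s_def using wl_stable_stable_round[OF fin] .
  have stable_G: "wl 3 G c (Suc s) vs = wl 3 G c (Suc s) ws"
    if "vs \<in> vertex_tuples 3 G" "ws \<in> vertex_tuples 3 G" "wl 3 G c s vs = wl 3 G c s ws" for vs ws
    using wl_stableD[OF stable InlI[OF that(1)] InlI[OF that(2)]] that(3)
    unfolding wl_joint_def sum.case .
  \<comment> \<open>Stability concerns the joint coloring, so it also compares triples of
    \<open>G\<close> with triples of \<open>H\<close>.\<close>
  have stable_GH: "wl 3 G c (Suc s) vs = wl 3 H d (Suc s) ws"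
    if "vs \<in> vertex_tuples 3 G" "ws \<in> vertex_tuples 3 H" "wl 3 G c s vs = wl 3 H d s ws" for vs ws
    using wl_stableD[OF stable InlI[OF that(1)] InrI[OF that(2)]] that(3)
    unfolding wl_joint_def sum.case .
  show False
  proof (cases "pverts G = {}")
    \<comment> \<open>Here there is nothing to individualize. \<open>H\<close> is empty too, since a
      triple \<open>[v, v, v]\<close> would have a color absent from \<open>G\<close>, and the empty
      map is an isomorphism.\<close>
    case True
    then have no_G: "vertex_tuples 3 G = {}" unfolding vertex_tuples_def by auto
    have "v \<notin> pverts H" for v
    proof
      assume "v \<in> pverts H"
      then have "[v, v, v] \<in> vertex_tuples 3 H" by (simp add: vertex_tuples_def)
      moreover have "{vs \<in> vertex_tuples 3 H. wl 3 H d s vs = wl 3 H d s [v, v, v]} = {}"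
        using card_eq[of "wl 3 H d s [v, v, v]"] no_G finite_vertex_tuples[OF fin(2)] by simp
      ultimately show False by blast
    qed
    then show False using True assms(7) unfolding colored_iso_def by (auto simp: bij_betw_def)
  next
    case False
    obtain a b where ab: "a \<in> pverts G" "b \<in> pverts G"
      and inj: "\<And>col :: 'a \<Rightarrow> wl_color. equitable_coloring G col \<Longrightarrow>
        equitable_coloring.uniquely_colored G col a \<Longrightarrow>
        equitable_coloring.uniquely_colored G col b \<Longrightarrow> inj_on col (pverts G)"
      using G.twin_width_one_individualization[OF assms(3,5) False] by metis
    define \<chi> where "\<chi> w = wl 3 G c s [a, b, w]" for w
    have eq: "equitable_coloring G \<chi>"
      unfolding \<chi>_def using G.equitable_coloring_wl[OF stable_G ab] by blast
    have "equitable_coloring.uniquely_colored G \<chi> v" if "v = a \<or> v = b" for v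
      unfolding equitable_coloring.uniquely_colored_def[OF eq] \<chi>_def
      using wl_individualized_unique[OF _ that] by (intro ballI impI)
    then have inj_G: "inj_on \<chi> (pverts G)" using inj[OF eq] by simp
    have in_G: "[a, b, w] \<in> vertex_tuples 3 G" if "w \<in> pverts G" for w
      using ab that by (simp add: vertex_tuples_def)
    \<comment> \<open>The third entry is a filler. As multiplicities agree, \<open>H\<close> has a
      triple of the same color, whose first two entries \<open>a'\<close> and \<open>b'\<close> take
      the roles of \<open>a\<close> and \<open>b\<close>.\<close>
    have "[a, b, a] \<in> {vs \<in> vertex_tuples 3 G. wl 3 G c s vs = \<chi> a}"
      using in_G[OF ab(1)] unfolding \<chi>_def by simp
    moreover have "finite {vs \<in> vertex_tuples 3 G. wl 3 G c s vs = \<chi> a}"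
      using finite_vertex_tuples[OF fin(1)] by simp
    ultimately have "card {vs \<in> vertex_tuples 3 H. wl 3 H d s vs = \<chi> a} \<noteq> 0"
      unfolding card_eq[symmetric] by (metis card_0_eq empty_iff)
    then have "{vs \<in> vertex_tuples 3 H. wl 3 H d s vs = \<chi> a} \<noteq> {}" by (metis card.empty)
    then obtain ws where ws: "ws \<in> vertex_tuples 3 H" "\<chi> a = wl 3 H d s ws" by auto
    moreover from ws(1) obtain a' b' e where "ws = [a', b', e]"
      unfolding vertex_tuples_def by (auto simp: length_Suc_conv numeral_3_eq_3)
    ultimately have ab': "[a', b', e] \<in> vertex_tuples 3 H" "\<chi> a = wl 3 H d s [a', b', e]" by simp_all
    define \<chi>' where "\<chi>' w = wl 3 H d s [a', b', w]" for w
    have in_H: "[a', b', w] \<in> vertex_tuples 3 H" if "w \<in> pverts H" for w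
      using ab' that by (simp add: vertex_tuples_def)
    have match: "{#(atp G c [a, b, v, u], \<chi> u). u \<in># mset_set (pverts G)#} =
        {#(atp H d [a', b', w, u], \<chi>' u). u \<in># mset_set (pverts H)#}"
      if "v \<in> pverts G" "[a', b', w] \<in> vertex_tuples 3 H" "\<chi> v = wl 3 H d s [a', b', w]" for v w
      using wl_3_Suc_eq[OF stable_GH[OF in_G[OF that(1)] that(2) that(3)[unfolded \<chi>_def]]]
      unfolding \<chi>_def \<chi>'_def .
    note match0 = match[OF ab(1) ab']
    have "image_mset snd {#(atp G c [a, b, a, u], \<chi> u). u \<in># mset_set (pverts G)#} =
        image_mset snd {#(atp H d [a', b', e, u], \<chi>' u). u \<in># mset_set (pverts H)#}"
      using match0 by (rule arg_cong)
    then have ms: "image_mset \<chi> (mset_set (pverts G)) = image_mset \<chi>' (mset_set (pverts H))"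
      by (simp add: image_mset.compositionality comp_def)
    have img: "\<chi> ` pverts G = \<chi>' ` pverts H"
      using arg_cong[OF ms, of set_mset] fin by simp
    \<comment> \<open>Equal images and equally many vertices carry injectivity from
      \<open>\<chi>\<close> over to \<open>\<chi>'\<close>.\<close>
    have "card (pverts G) = card (pverts H)"
      using arg_cong[OF ms, of size] by simp
    then have inj_H: "inj_on \<chi>' (pverts H)"
      using card_image[OF inj_G] img fin(2) by (intro eq_card_imp_inj_on) auto
    \<comment> \<open>\<open>f\<close> sends a vertex to the vertex of \<open>H\<close> with the
      same color.\<close>
    define f where "f = inv_into (pverts H) \<chi>' \<circ> \<chi>"
    have bij: "bij_betw f (pverts G) (pverts H)"
      unfolding f_def
    proof (rule bij_betw_trans)
      show "bij_betw \<chi> (pverts G) (\<chi>' ` pverts H)" using inj_G img by (simp add: bij_betw_def)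
      show "bij_betw (inv_into (pverts H) \<chi>') (\<chi>' ` pverts H) (pverts H)"
        using bij_betw_inv_into[OF inj_on_imp_bij_betw[OF inj_H]] .
    qed
    have f: "f v \<in> pverts H" "\<chi>' (f v) = \<chi> v" if "v \<in> pverts G" for v
    proof -
      have "\<chi> v \<in> \<chi>' ` pverts H" unfolding img[symmetric] using that by (rule imageI)
      then show "f v \<in> pverts H" "\<chi>' (f v) = \<chi> v"
        unfolding f_def by (simp_all add: f_inv_into_f inv_into_into)
    qed
    \<comment> \<open>Comparing the multisets at \<open>v\<close> and \<open>f v\<close> yields a
      vertex \<open>u'\<close> of color \<open>\<chi> u\<close> with the same atomic type, and
      \<open>inj_H\<close> forces \<open>u' = f u\<close>. Adjacency and vertex colors can then be
      read off the atomic type.\<close>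
    have atp_f: "atp G c [a, b, v, u] = atp H d [a', b', f v, f u]"
      if vu: "v \<in> pverts G" "u \<in> pverts G" for v u
    proof -
      have "{#(atp G c [a, b, v, u], \<chi> u). u \<in># mset_set (pverts G)#} =
          {#(atp H d [a', b', f v, u], \<chi>' u). u \<in># mset_set (pverts H)#}"
        using match[OF vu(1) in_H] f[OF vu(1)] unfolding \<chi>'_def by simp
      from arg_cong[OF this, of set_mset]
      have "(\<lambda>u. (atp G c [a, b, v, u], \<chi> u)) ` pverts G =
          (\<lambda>u. (atp H d [a', b', f v, u], \<chi>' u)) ` pverts H"
        using fin by simp
      from equalityD1[OF this, THEN subsetD, OF imageI[OF vu(2)]]
      obtain u' where u': "u' \<in> pverts H" "\<chi>' u' = \<chi> u"
        "atp G c [a, b, v, u] = atp H d [a', b', f v, u']"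
        by (elim imageE) simp
      have "u' = f u"
        using inj_onD[OF inj_H _ u'(1) f(1)[OF vu(2)]] u'(2) f(2)[OF vu(2)] by simp
      with u'(3) show ?thesis by simp
    qed
    have "(u, v) \<in> parcs G \<longleftrightarrow> (f u, f v) \<in> parcs H" if "u \<in> pverts G" "v \<in> pverts G" for u v
    proof -
      have "(2, 3) \<in> snd (snd (atp G c [a, b, u, v])) \<longleftrightarrow>
          (2, 3) \<in> snd (snd (atp H d [a', b', f u, f v]))"
        using atp_f[OF that] by simp
      then show ?thesis by (simp add: atp_def)
    qed
    moreover have "d (f u) = c u" if "u \<in> pverts G" for u
      using atp_f[OF that that] by (simp add: atp_def)
    ultimately show False using assms(7) bij unfolding colored_iso_def by blast
  qed
qed

end
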